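(* For every integer $n\geq 2$, $$\lfloor e^{w(n)}\rfloor -2\leq K_n\leq \lfloor e^{w(n)}\rfloor +1.$$
   Context: $S(n,k)$ denotes the Stirling number of the second kind (the number of partitions of $\{1,\ldots,n\}$ into $k$ nonempty blocks), with $S(n,k)=0$ for $k=0$ (when $n\geq1$) and for $k>n$. For $n\geq 1$ the sequence $S(n,1),\ldots,S(n,n)$ is strictly log-concave, so there is a unique integer $K_n$ with $1\leq K_n\leq n$ such that $S(n,K_n-1)<S(n,K_n)\geq S(n,K_n+1)$. $w(n)$ denotes Lambert's W function, i.e. the unique real $w>0$ with $n=we^{w}$ (for $n>0$). $\lfloor x\rfloor$ is the integer part of $x$. *)

theory Defs
  imports "HOL-Analysis.Analysis" "HOL-Combinatorics.Stirling"
begin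

definition stirling_mode :: "nat \<Rightarrow> nat" where
  "stirling_mode n = (THE k. 1 \<le> k \<and> k \<le> n \<and>
      Stirling n (k - 1) < Stirling n k \<and> Stirling n k \<ge> Stirling n (k + 1))"

definition lambertW :: "real \<Rightarrow> real" where
  "lambertW x = (THE w. w > 0 \<and> x = w * exp w)"

end

theory Submission
  imports Defs "HOL-Computational_Algebra.Fundamental_Theorem_Algebra"
begin

text \<open>
  The polynomial \<open>T\<^sub>n(x) = \<Sum>k. S(n,k) x\<^sup>k\<close> has only real roots, all of them \<open>\<le> 0\<close>, so \<open>k \<mapsto> S(n,k) / B\<^sub>n\<close>
  is the distribution of a sum of independent Bernoulli variables. By Darroch's theorem its mode
  differs from its mean \<open>B\<^sub>n\<^sub>+\<^sub>1 / B\<^sub>n - 1\<close> by at most 1. Writing \<open>E = e\<^sup>w\<close>, the theorem thus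
  follows from \<open>E - 1 < B\<^sub>n\<^sub>+\<^sub>1 / B\<^sub>n < E + 1\<close>. By Dobinski's formula this ratio is the mean of
  the law \<open>P(Y = k) \<propto> k\<^sup>n / k!\<close>, and shifting the summation index gives
  \<open>E[(1 + 1/Y)\<^sup>n] \<le> E[Y]\<close> and \<open>E[Y (1 - 1/Y)\<^sup>n] = 1\<close>. Both integrands are convex, and
  comparing them with their tangents at \<open>E - 1\<close> and \<open>E + 1\<close> yields the two bounds.
\<close>

subsection \<open>Darroch's theorem for sums of Bernoulli variables\<close>

text \<open>For parameters in [0, 1] this is the probability generating function of a sum of
  independent Bernoulli variables.\<close>

definition bernoulli_poly :: "real multiset \<Rightarrow> real poly" where
  "bernoulli_poly M = (\<Prod>p\<in>#M. [:1 - p, p:])"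

lemma bernoulli_poly_simps [simp]:
  "bernoulli_poly {#} = 1"
  "bernoulli_poly (add_mset p M) = [:1 - p, p:] * bernoulli_poly M"
  by (simp_all add: bernoulli_poly_def del: mult_pCons_left)

lemma coeff_bernoulli_poly_nonneg:
  assumes "\<forall>p\<in>#M. 0 \<le> p \<and> p \<le> 1"
  shows "0 \<le> coeff (bernoulli_poly M) k"
  using assms
proof (induction M arbitrary: k)
  case (add p M)
  then show ?case by (cases k) auto
qed (auto simp: coeff_1)

lemma sum_mset_nonneg_eq_0D:
  fixes f :: "'a \<Rightarrow> real"
  assumes "\<And>p. p \<in># M \<Longrightarrow> 0 \<le> f p" "(\<Sum>p\<in>#M. f p) = 0" "p \<in># M"
  shows "f p = 0"
  using assms
proof (induction M arbitrary: p)
  case (add q M)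
  have "0 \<le> (\<Sum>p\<in>#M. f p)" "0 \<le> f q"
    using add.prems(1) sum_mset_mono[of M "\<lambda>_. 0" f] by auto
  with add.prems(2) have "f q = 0" "(\<Sum>p\<in>#M. f p) = 0" by auto
  with add show ?case by auto
qed simp

text \<open>The deviations from the mean \<open>a\<close> add up to 0, so if they all had one sign
  they would all vanish, contrary to \<open>p\<close>.\<close>

lemma exists_less_and_greater_mean:
  fixes M :: "real multiset"
  assumes "sum_mset M = real (size M) * a" "p \<in># M" "p \<noteq> a"
  obtains x y where "x \<in># M" "x < a" "y \<in># M" "a < y"
proof -
  have *: "(\<Sum>p\<in>#M. p - c) = sum_mset M - real (size M) * c" for c :: real and M
    by (induction M) (auto simp: algebra_simps)
  have **: "(\<Sum>p\<in>#M. c - p) = real (size M) * c - sum_mset M" for c :: real and M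
    by (induction M) (auto simp: algebra_simps)
  have "\<exists>x\<in>#M. x < a"
  proof (rule ccontr)
    assume "\<not> ?thesis"
    then have "p - a = 0"
      by (intro sum_mset_nonneg_eq_0D[of M "\<lambda>p. p - a"]) (use assms in \<open>auto simp: * not_less\<close>)
    with assms show False by simp
  qed
  moreover have "\<exists>y\<in>#M. a < y"
  proof (rule ccontr)
    assume "\<not> ?thesis"
    then have "a - p = 0"
      by (intro sum_mset_nonneg_eq_0D[of M "\<lambda>p. a - p"]) (use assms in \<open>auto simp: ** not_less\<close>)
    with assms show False by simp
  qed
  ultimately show ?thesis using that by blast
qed

lemma coeff_one_minus_X_mult_Suc:
  "coeff ([:1, -1:] * P) (Suc j) = coeff P (Suc j) - coeff (P :: real poly) j"
  by simp

text \<open>The factor 1 - X turns coefficients into differences of neighbours, with 0 standing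
  before the coefficient of index 0. The claim is then the usual comparison of successive binomial
  probabilities.\<close>

lemma binomial_coeff_diff_nonneg:
  fixes a :: real
  assumes "0 < a" "a < 1" "real k \<le> real m * a"
  shows "0 \<le> coeff ([:1, -1:] * [:1 - a, a:] ^ m) k"
proof (cases k)
  case 0
  then show ?thesis using assms by (simp add: coeff_linear_poly_power)
next
  case (Suc j)
  have "m > 0" using assms Suc by (cases m) auto
  then have "real k < real m" using assms
    by (smt (verit) mult_less_cancel_left2 of_nat_0_less_iff)
  then have jm: "Suc j \<le> m" using Suc by simp
  then obtain l where m: "m = Suc (j + l)" by (metis add_Suc less_eqE)
  have b: "real (Suc j) * real (m choose Suc j) = real (Suc l) * real (m choose j)"
  proof -
    have "Suc j * (m choose Suc j) = (m - j) * (m choose j)"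
      by (simp only: binomial_absorption binomial_absorb_comp)
    then have "real (Suc j * (m choose Suc j)) = real (Suc l * (m choose j))"
      using m by (simp only: add_Suc_right[symmetric] add_diff_cancel_left')
    then show ?thesis by (simp only: of_nat_mult)
  qed
  \<comment> \<open>With the common binomial coefficient removed, this says
    \<open>Suc j \<le> (m + 1) * a\<close>, which is weaker than
    \<open>k \<le> m * a\<close>.\<close>
  have "real (Suc j) * ((1 - a) * real (m choose j)) \<le> real (Suc l) * a * real (m choose j)"
    unfolding mult.assoc[symmetric] using assms Suc m by (intro mult_right_mono) (auto simp: algebra_simps)
  also have "\<dots> = real (Suc j) * (a * real (m choose Suc j))"
    using b by (simp add: algebra_simps)
  finally have c: "(1 - a) * real (m choose j) \<le> a * real (m choose Suc j)"
    by (simp del: of_nat_Suc binomial_Suc_Suc)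
  have "coeff ([:1, -1:] * [:1 - a, a:] ^ m) k
      = real (m choose Suc j) * a ^ Suc j * (1 - a) ^ l - real (m choose j) * a ^ j * (1 - a) ^ Suc l"
    unfolding Suc coeff_one_minus_X_mult_Suc
    using m by (simp add: coeff_linear_poly_power Suc_diff_le del: binomial_Suc_Suc power_Suc)
  also have "\<dots> = a ^ j * (1 - a) ^ l * (a * real (m choose Suc j) - (1 - a) * real (m choose j))"
    by (simp add: algebra_simps del: binomial_Suc_Suc)
  also have "\<dots> \<ge> 0"
    using c assms by (intro mult_nonneg_nonneg) auto
  finally show ?thesis .
qed

text \<open>The product of the two factors is 1 + (x + y)(X - 1) + xy(X - 1)^2, so pairs with equal
  sums differ only in the last term.\<close>

lemma coeff_diff_replace_pair:
  fixes k :: nat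
  assumes "x + y = x' + y'"
  shows "coeff ([:1, -1:] * bernoulli_poly (add_mset x (add_mset y N))) k
       = coeff ([:1, -1:] * bernoulli_poly (add_mset x' (add_mset y' N))) k
         + (x * y - x' * y') * coeff ([:1, -1:] * [:-1, 1:] ^ 2 * bernoulli_poly N) k"
proof -
  have e: "[:1 - x, x:] * [:1 - y, y:] = [:1 - x', x':] * [:1 - y', y':] + smult (x * y - x' * y') ([:-1, 1:] ^ 2)"
  proof -
    have "y = x' + y' - x" using assms by simp
    then show ?thesis by (simp add: power2_eq_square algebra_simps)
  qed
  have "[:1, -1:] * bernoulli_poly (add_mset x (add_mset y N)) =
    [:1, -1:] * ([:1 - x, x:] * [:1 - y, y:]) * bernoulli_poly N"
    by (simp only: bernoulli_poly_simps mult.assoc)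
  also have "\<dots> = [:1, -1:] * bernoulli_poly (add_mset x' (add_mset y' N)) +
     smult (x * y - x' * y') ([:1, -1:] * [:-1, 1:] ^ 2 * bernoulli_poly N)"
    unfolding e by (simp only: bernoulli_poly_simps mult.assoc distrib_left distrib_right mult_smult_left mult_smult_right)
  finally show ?thesis by (simp only: coeff_add coeff_smult)
qed

text \<open>
  Hoeffding's argument. With \<open>x + y\<close> fixed, the coefficient is affine in \<open>x * y\<close>. Depending on the sign
  of the slope, a pair on both sides of the mean is pushed apart until one of its members is 0 or 1 (and can
  be dropped), or pulled together until one of them equals the mean. This ends with all parameters equal,
  the binomial case.
\<close>
lemma coeff_bernoulli_poly_diff_nonneg:
  assumes "\<forall>p\<in>#M. 0 \<le> p \<and> p \<le> 1" "real k \<le> sum_mset M"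
  shows "0 \<le> coeff ([:1, -1:] * bernoulli_poly M) k"
proof -
  \<comment> \<open>The induction is lexicographic: first on the number of parameters, then on how
    many of them differ from the mean.\<close>
  define dev where "dev M = size {#p \<in># M. p \<noteq> sum_mset M / real (size M)#}" for M :: "real multiset"
  have "wf (measures [size, dev])" by simp
  then show ?thesis using assms
  proof (induction M arbitrary: k rule: wf_induct_rule)
    case (less M)
    note IH = less.IH and range = less.prems(1) and sum = less.prems(2)
    \<comment> \<open>A parameter 0 or 1 splits off a factor 1 or X. What remains has smaller size,
      so \<open>IH\<close> applies to it; in the case of X, index and mean both drop by 1.\<close>
    have boundary: "0 \<le> coeff ([:1, -1:] * bernoulli_poly M') k"
      if M': "size M' = size M" "sum_mset M' = sum_mset M" "\<forall>p\<in>#M'. 0 \<le> p \<and> p \<le> 1"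
        "0 \<in># M' \<or> 1 \<in># M'" for M'
      using M'(4)
    proof
      assume "0 \<in># M'"
      then obtain N where N: "M' = add_mset 0 N" by (metis insert_DiffM)
      have "0 \<le> coeff ([:1, -1:] * bernoulli_poly N) k"
        using M' N sum by (intro IH) auto
      then show ?thesis by (simp add: N)
    next
      assume "1 \<in># M'"
      then obtain N where N: "M' = add_mset 1 N" by (metis insert_DiffM)
      show ?thesis
      proof (cases k)
        case 0
        then show ?thesis by (simp add: N)
      next
        case (Suc j)
        have "0 \<le> coeff ([:1, -1:] * bernoulli_poly N) j"
          using M' N sum Suc by (intro IH) auto
        then show ?thesis by (cases j) (simp_all add: N Suc)
      qed
    qed
    show ?case
    proof (cases "0 \<in># M \<or> 1 \<in># M")
      case True
      then show ?thesis using boundary range by blast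
    next
      case False
      then have inner: "0 < p" "p < 1" if "p \<in># M" for p
        using range that by (auto simp: less_le)
      define a where "a = sum_mset M / real (size M)"
      show ?thesis
      proof (cases "\<forall>p\<in>#M. p = a")
        case True
        then have M: "M = replicate_mset (size M) a"
          by (metis set_mset_subset_singletonD subsetI singletonI)
        show ?thesis
        proof (cases "M = {#}")
          case True
          then show ?thesis using sum by (cases k) auto
        next
          case nonempty: False
          then have "a \<in># M" using True by (metis multiset_nonemptyE)
          moreover have "bernoulli_poly M = [:1 - a, a:] ^ size M"
            by (subst M) (simp add: bernoulli_poly_def)
          ultimately show ?thesis
            using inner[of a] sum nonempty
            by (simp only:, intro binomial_coeff_diff_nonneg) (auto simp: a_def)
        qed
      next
        case False
        then obtain p where "p \<in># M" "p \<noteq> a" by blast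
        moreover have "sum_mset M = real (size M) * a"
          using \<open>p \<in># M\<close> by (auto simp: a_def)
        ultimately obtain x y where xy: "x \<in># M" "x < a" "y \<in># M" "a < y"
          using exists_less_and_greater_mean by blast
        then obtain N where N: "M = add_mset x (add_mset y N)"
          by (metis insert_DiffM insert_noteq_member less_asym)
        define c where "c = coeff ([:1, -1:] * [:-1, 1:] ^ 2 * bernoulli_poly N) k"
        have rN: "\<forall>p\<in>#N. 0 \<le> p \<and> p \<le> 1" using range N by auto
        have i: "0 < x" "y < 1" "0 < y" "x < 1" using inner xy by auto
        show ?thesis
        proof (cases "c \<ge> 0")
          case True
          \<comment> \<open>The pair in the unit square with the given sum that is furthest apart:
            \<open>x' = 0\<close> or \<open>y' = 1\<close>, and the product is smallest.\<close>
          define x' y' where "x' = max 0 (x + y - 1)" and "y' = min 1 (x + y)"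
          have eq: "x + y = x' + y'" by (auto simp: x'_def y'_def)
          have "x' * y' \<le> x * y"
          proof (cases "x + y \<le> 1")
            case False
            have "0 \<le> (1 - x) * (1 - y)" using i by simp
            then show ?thesis using False by (simp add: x'_def y'_def algebra_simps)
          qed (use i in \<open>simp add: x'_def y'_def\<close>)
          then have "0 \<le> (x * y - x' * y') * c" using True by simp
          moreover have "0 \<le> coeff ([:1, -1:] * bernoulli_poly (add_mset x' (add_mset y' N))) k"
            using i rN eq N by (intro boundary) (auto simp: x'_def y'_def)
          ultimately show ?thesis
            unfolding N coeff_diff_replace_pair[OF eq] c_def[symmetric] by linarith
        next
          case False
          \<comment> \<open>Moving \<open>x\<close> to the mean raises the product by (a - x)(y -
            a). The mean stays \<open>a\<close>; both \<open>x\<close> and \<open>y\<close> counted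
            in \<open>dev\<close>, and now at most \<open>z\<close> does.\<close>
          define z where "z = x + y - a"
          define M' where "M' = add_mset a (add_mset z N)"
          have eq: "x + y = a + z" by (simp add: z_def)
          have "0 \<le> (a - x) * (y - a)" using xy by simp
          then have "x * y \<le> a * z" by (simp add: z_def algebra_simps)
          then have "0 \<le> (x * y - a * z) * c" using False by (simp add: mult_nonpos_nonpos)
          moreover have "0 \<le> coeff ([:1, -1:] * bernoulli_poly M') k"
          proof (rule IH)
            have s: "size M' = size M" "sum_mset M' = sum_mset M"
              using eq by (auto simp: M'_def N)
            have "dev M' < dev M" unfolding dev_def s a_def[symmetric]
              using xy by (simp add: M'_def N)
            then show "(M', M) \<in> measures [size, dev]" using s by simp
            show "\<forall>p\<in>#M'. 0 \<le> p \<and> p \<le> 1"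
              using rN xy i by (auto simp: M'_def z_def)
            show "real k \<le> sum_mset M'" using s sum by simp
          qed
          ultimately show ?thesis
            unfolding N coeff_diff_replace_pair[OF eq] c_def[symmetric] M'_def by linarith
        qed
      qed
    qed
  qed
qed

text \<open>
  Exponential tilting: \<open>q\<^sub>k x\<^sup>k\<close> is proportional to a sum of Bernoulli variables with parameters
  \<open>x / (r + x)\<close>. A tilt with \<open>x < 1\<close> later turns the weak inequality into a strict one.
\<close>
lemma coeff_prod_linear_scale:
  fixes x :: real
  assumes "0 < x" "\<forall>r\<in>#R. 0 \<le> r"
  shows "coeff (\<Prod>r\<in>#R. [:r, 1:]) k * x ^ k =
    (\<Prod>r\<in>#R. r + x) * coeff (bernoulli_poly (image_mset (\<lambda>r. x / (r + x)) R)) k"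
  using assms(2)
proof (induction R arbitrary: k)
  case empty
  then show ?case by (cases k) simp_all
next
  case (add r R)
  have nz: "r + x \<noteq> 0" using add.prems assms(1) by (metis add_nonneg_pos insert_iff less_irrefl set_mset_add_mset_insert)
  define q P where "q = (\<Prod>r\<in>#R. [:r, 1:])" and "P = bernoulli_poly (image_mset (\<lambda>r. x / (r + x)) R)"
  have IH: "coeff q i * x ^ i = (\<Prod>r\<in>#R. r + x) * coeff P i" for i
    unfolding q_def P_def using add by auto
  have eqs: "(r + x) * (1 - x / (r + x)) = r" "(r + x) * (x / (r + x)) = x"
    using nz by (simp_all add: field_simps)
  have P: "(r + x) * coeff ([:1 - x / (r + x), x / (r + x):] * P) k = coeff ([:r, x:] * P) k"
  proof -
    have "[:r, x:] = smult (r + x) [:1 - x / (r + x), x / (r + x):]"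
      by (simp only: smult_pCons eqs smult_0_right)
    then show ?thesis by (simp only: mult_smult_left coeff_smult)
  qed
  have "coeff ([:r, 1:] * q) k * x ^ k = (\<Prod>r\<in>#R. r + x) * coeff ([:r, x:] * P) k"
  proof (cases k)
    case 0
    then show ?thesis using IH[of 0] by simp
  next
    case (Suc j)
    then show ?thesis using IH[of j] IH[of "Suc j"] by (simp add: algebra_simps)
  qed
  then show ?case unfolding P[symmetric]
    by (simp only: image_mset_add_mset prod_mset.add_mset bernoulli_poly_simps q_def P_def mult_ac)
qed

text \<open>The law tilted by \<open>x\<close> has mean at least \<open>Suc j\<close>, so it does
  not fall from \<open>j\<close> to \<open>Suc j\<close>. Undoing the tilt leaves one factor
  \<open>x\<close>.\<close>

lemma coeff_prod_linear_le_of_mean: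
  fixes x :: real
  assumes "0 < x" "\<forall>r\<in>#R. 0 \<le> r" "real (Suc j) \<le> (\<Sum>r\<in>#R. x / (r + x))"
  shows "coeff (\<Prod>r\<in>#R. [:r, 1:]) j \<le> x * coeff (\<Prod>r\<in>#R. [:r, 1:]) (Suc j)"
proof -
  let ?Q = "\<Prod>r\<in>#R. [:r, 1:]"
  define M where "M = image_mset (\<lambda>r. x / (r + x)) R"
  have "\<forall>p\<in>#M. 0 \<le> p \<and> p \<le> 1" using assms(1,2) by (auto simp: M_def)
  then have "coeff (bernoulli_poly M) j \<le> coeff (bernoulli_poly M) (Suc j)"
    using coeff_bernoulli_poly_diff_nonneg[of M "Suc j"] assms(3) by (simp add: M_def)
  moreover have "0 \<le> (\<Prod>r\<in>#R. r + x)"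
    using assms(1,2) by (induction R) auto
  ultimately have "coeff ?Q j * x ^ j \<le> coeff ?Q (Suc j) * x ^ Suc j"
    unfolding coeff_prod_linear_scale[OF assms(1,2)] M_def by (rule mult_left_mono)
  then have "x ^ j * coeff ?Q j \<le> x ^ j * (x * coeff ?Q (Suc j))" by (simp add: mult_ac)
  then show ?thesis using assms(1) by simp
qed

text \<open>By continuity the strict bound on the mean survives a tilt by some \<open>x < 1\<close>,
  and this factor makes the inequality strict.\<close>

lemma coeff_prod_linear_less_of_mean:
  assumes "\<forall>r\<in>#R. (0 :: real) \<le> r" "real (Suc j) < (\<Sum>r\<in>#R. 1 / (r + 1))"
    "0 < coeff (\<Prod>r\<in>#R. [:r, 1:]) (Suc j)"
  shows "coeff (\<Prod>r\<in>#R. [:r, 1:]) j < coeff (\<Prod>r\<in>#R. [:r, 1:]) (Suc j)"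
proof -
  have "isCont (\<lambda>x. \<Sum>r\<in>#R. x / (r + x)) 1"
    using assms(1) by (induction R) (auto intro!: continuous_intros)
  then have "((\<lambda>x. \<Sum>r\<in>#R. x / (r + x)) \<longlongrightarrow> (\<Sum>r\<in>#R. 1 / (r + 1))) (at_left 1)"
    by (simp add: isCont_def filterlim_at_split)
  then have "\<forall>\<^sub>F x in at_left 1. real (Suc j) < (\<Sum>r\<in>#R. x / (r + x))"
    using assms(2) by (rule order_tendstoD)
  moreover have "\<forall>\<^sub>F x :: real in at_left 1. x \<in> {0<..<1}"
    by (rule eventually_at_leftI[of 0]) auto
  ultimately have "\<forall>\<^sub>F x in at_left 1. x \<in> {0<..<1} \<and> real (Suc j) < (\<Sum>r\<in>#R. x / (r + x))"
    by eventually_elim auto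
  then obtain x where x: "0 < x" "x < 1" "real (Suc j) < (\<Sum>r\<in>#R. x / (r + x))"
    using eventually_happens'[OF trivial_limit_at_left_real] by auto
  have "coeff (\<Prod>r\<in>#R. [:r, 1:]) j \<le> x * coeff (\<Prod>r\<in>#R. [:r, 1:]) (Suc j)"
    using x assms(1) by (intro coeff_prod_linear_le_of_mean) auto
  also have "\<dots> < coeff (\<Prod>r\<in>#R. [:r, 1:]) (Suc j)"
    using x assms(3) by simp
  finally show ?thesis .
qed

lemma degree_bernoulli_poly:
  assumes "0 \<notin># M"
  shows "degree (bernoulli_poly M) = size M"
  using assms
proof (induction M)
  case (add p M)
  have "bernoulli_poly M \<noteq> 0"
    by (auto simp: bernoulli_poly_def)
  then have "degree ([:1 - p, p:] * bernoulli_poly M) = degree [:1 - p, p:] + degree (bernoulli_poly M)"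
    using add.prems by (intro degree_mult_eq) auto
  then show ?case using add by (simp del: mult_pCons_left)
qed simp

text \<open>Reversing the coefficients exchanges success and failure. A parameter 0 would lower the
  degree and shift the reversal.\<close>

lemma reflect_bernoulli_poly:
  assumes "0 \<notin># M"
  shows "reflect_poly (bernoulli_poly M) = bernoulli_poly (image_mset (\<lambda>p. 1 - p) M)"
  using assms
proof (induction M)
  case (add p M)
  then have "reflect_poly [:1 - p, p:] = [:p, 1 - p:]"
    by (simp add: reflect_poly_pCons' monom_Suc monom_0)
  with add show ?case by (simp add: reflect_poly_mult del: mult_pCons_left)
qed simp

lemma coeff_prod_linear_ge_of_mean:
  assumes "\<forall>r\<in>#R. (0 :: real) \<le> r" "(\<Sum>r\<in>#R. 1 / (r + 1)) \<le> real j"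
  shows "coeff (\<Prod>r\<in>#R. [:r, 1:]) (Suc j) \<le> coeff (\<Prod>r\<in>#R. [:r, 1:]) j"
proof -
  define M where "M = image_mset (\<lambda>r. 1 / (r + 1)) R"
  have M: "\<forall>p\<in>#M. 0 < p \<and> p \<le> 1" using assms(1) by (auto simp: M_def)
  then have nz: "0 \<notin># M" by auto
  have "coeff (bernoulli_poly M) (Suc j) \<le> coeff (bernoulli_poly M) j"
  proof (cases "Suc j \<le> size M")
    case True
    then obtain i where i: "size M = Suc (j + i)" by (metis add_Suc less_eqE)
    \<comment> \<open>Counting failures swaps the indices \<open>Suc j\<close> and \<open>j\<close>
      with \<open>i\<close> and \<open>Suc i\<close>, so the descent becomes an ascent below the
      mean of \<open>M'\<close>.\<close>
    define M' where "M' = image_mset (\<lambda>p. 1 - p) M"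
    have "sum_mset M' = real (size M) - sum_mset M"
      unfolding M'_def by (induction M) auto
    then have "real (Suc i) \<le> sum_mset M'"
      using i assms(2) by (simp add: M_def)
    then have "0 \<le> coeff ([:1, -1:] * bernoulli_poly M') (Suc i)"
      using M by (intro coeff_bernoulli_poly_diff_nonneg) (auto simp: M'_def)
    then show ?thesis
      unfolding M'_def reflect_bernoulli_poly[OF nz, symmetric]
      using i by (simp add: coeff_reflect_poly degree_bernoulli_poly[OF nz])
  next
    case False
    then have "coeff (bernoulli_poly M) (Suc j) = 0"
      by (intro coeff_eq_0) (simp add: degree_bernoulli_poly[OF nz])
    then show ?thesis using M by (auto intro!: coeff_bernoulli_poly_nonneg simp: less_imp_le)
  qed
  moreover have "0 \<le> (\<Prod>r\<in>#R. r + 1)"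
    using assms(1) by (induction R) auto
  ultimately show ?thesis
    using coeff_prod_linear_scale[OF zero_less_one assms(1)]
    by (simp add: M_def mult_left_mono)
qed

subsection \<open>Real-rootedness of the Touchard polynomials\<close>

lemma lead_coeff_prod_linear:
  fixes R :: "'a :: idom multiset"
  shows "lead_coeff (\<Prod>r\<in>#R. [:r, 1:]) = 1"
  by (induction R) (simp_all add: lead_coeff_mult del: mult_pCons_left)

lemma degree_prod_linear:
  fixes R :: "'a :: idom multiset"
  shows "degree (\<Prod>r\<in>#R. [:r, 1:]) = size R"
proof (induction R)
  case (add r R)
  have "(\<Prod>r\<in>#R. [:r, 1:]) \<noteq> 0"
    using lead_coeff_prod_linear[of R] by auto
  then have "degree ([:r, 1:] * (\<Prod>r\<in>#R. [:r, 1:])) = degree [:r, 1:] + degree (\<Prod>r\<in>#R. [:r, 1:])"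
    by (intro degree_mult_eq) auto
  then show ?case using add by (simp del: mult_pCons_left)
qed simp

text \<open>The logarithmic derivative: over the complex numbers it locates roots, and over the
  reals at \<open>z = 1\<close> it gives the mean.\<close>

lemma poly_pderiv_prod_linear:
  fixes R :: "'a :: {field_char_0} multiset"
  assumes "\<forall>r\<in>#R. r + z \<noteq> 0"
  shows "poly (pderiv (\<Prod>r\<in>#R. [:r, 1:])) z = poly (\<Prod>r\<in>#R. [:r, 1:]) z * (\<Sum>r\<in>#R. 1 / (r + z))"
  using assms
proof (induction R)
  case (add r R)
  have "pderiv [:r, 1:] = 1" by (simp add: pderiv_pCons)
  with add show ?case
    by (simp add: pderiv_mult field_simps del: mult_pCons_left)
qed simp

text \<open>
  The sum is the logarithmic derivative of \<open>Q = \<Prod>(X + r)\<close>, so this confines the roots of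
  \<open>Q + Q'\<close> to the nonpositive reals.
\<close>
lemma sum_inverse_shift_neq_minus_1:
  assumes "\<forall>r\<in>#R. (0 :: real) \<le> r" "Im z \<noteq> 0 \<or> 0 < Re z"
  shows "(\<Sum>r\<in>#R. 1 / (complex_of_real r + z)) \<noteq> -1"
proof
  assume eq: "(\<Sum>r\<in>#R. 1 / (complex_of_real r + z)) = -1"
  \<comment> \<open>The imaginary part of the sum is \<open>- Im z\<close> times a sum of positive
    terms, so a nonreal \<open>z\<close> forces \<open>R\<close> to be empty. For real
    \<open>z > 0\<close> the sum is nonnegative.\<close>
  define s where "s r = 1 / (cmod (complex_of_real r + z))\<^sup>2" for r
  have ReIm: "1 / (complex_of_real r + z) = Complex ((r + Re z) * s r) (- Im z * s r)" for r
    by (simp add: complex_eq_iff s_def Re_divide Im_divide cmod_power2)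
  have Im: "Im (\<Sum>r\<in>#R. 1 / (complex_of_real r + z)) = - Im z * (\<Sum>r\<in>#R. s r)"
    unfolding ReIm by (induction R) (auto simp: algebra_simps)
  have Re: "Re (\<Sum>r\<in>#R. 1 / (complex_of_real r + z)) = (\<Sum>r\<in>#R. (r + Re z) * s r)"
    unfolding ReIm by (induction R) (auto simp: algebra_simps)
  show False
  proof (cases "Im z = 0")
    case True
    then have "0 \<le> (\<Sum>r\<in>#R. (r + Re z) * s r)"
      using assms by (induction R) (auto simp: s_def)
    then show False using eq Re by simp
  next
    case False
    then have "(\<Sum>r\<in>#R. s r) = 0" using eq Im by simp
    moreover have "0 \<le> s r" for r by (simp add: s_def)
    ultimately have "s r = 0" if "r \<in># R" for r
      using that by (intro sum_mset_nonneg_eq_0D[of R s])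
    moreover have "s r > 0" for r
      using False by (auto simp: s_def complex_eq_iff)
    ultimately have "R = {#}" by (metis less_irrefl multiset_nonemptyE)
    then show False using eq by simp
  qed
qed

text \<open>Q + Q' splits over the complex numbers. At a root \<open>z\<close> that is not a
  nonpositive real, Q is nonzero, so Q'/Q would equal -1. Hence every root is real and
  \<open>\<le> 0\<close>, and the factorization descends to the reals.\<close>

lemma splits_add_pderiv:
  assumes R: "\<forall>r\<in>#R. (0 :: real) \<le> r"
  obtains R' where "\<forall>r\<in>#R'. 0 \<le> r"
    "(\<Prod>r\<in>#R. [:r, 1:]) + pderiv (\<Prod>r\<in>#R. [:r, 1:]) = (\<Prod>r\<in>#R'. [:r, 1:])"
proof -
  let ?Q = "\<Prod>r\<in>#R. [:r, 1:]"
  define Q where "Q = (\<Prod>r\<in>#image_mset complex_of_real R. [:r, 1:])"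
  define P where "P = Q + pderiv Q"
  have P_real: "poly P (of_real x) = of_real (poly (?Q + pderiv ?Q) x)" for x
  proof -
    have "poly Q (of_real x) = of_real (poly ?Q x)"
      unfolding Q_def by (induction R) simp_all
    moreover have "poly (pderiv Q) (of_real x) = of_real (poly (pderiv ?Q) x)"
      unfolding Q_def
    proof (induction R)
      case (add r R)
      have "poly (\<Prod>r\<in>#image_mset complex_of_real R. [:r, 1:]) (of_real x) = of_real (poly (\<Prod>r\<in>#R. [:r, 1:]) x)"
        by (induction R) simp_all
      with add show ?case
        by (simp add: pderiv_mult pderiv_pCons del: mult_pCons_left)
    qed simp
    ultimately show ?thesis by (simp add: P_def)
  qed
  have monic: "lead_coeff P = 1"
  proof (cases "degree Q = 0")
    case True
    then have "pderiv Q = 0" by (simp add: pderiv_eq_0_iff)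
    then show ?thesis using lead_coeff_prod_linear by (simp add: P_def Q_def)
  next
    case False
    then have "degree (pderiv Q) < degree Q" by (simp add: degree_pderiv)
    then show ?thesis
      using lead_coeff_prod_linear[of "image_mset complex_of_real R"]
      by (simp add: P_def degree_add_eq_left coeff_eq_0 flip: Q_def)
  qed
  then have "P \<noteq> 0" by auto
  then obtain A where A: "P = (\<Prod>z\<in>#A. [:-z, 1:])"
    using alg_closed_imp_factorization[of P] monic by auto
  have root: "Im z = 0 \<and> Re z \<le> 0" if "z \<in># A" for z
  proof (rule ccontr)
    assume "\<not> ?thesis"
    then have z: "Im z \<noteq> 0 \<or> 0 < Re z" by auto
    have nz: "of_real r + z \<noteq> 0" if "r \<in># R" for r
      using z R that by (fastforce simp: complex_eq_iff)
    have "poly P z = poly Q z * (1 + (\<Sum>r\<in>#R. 1 / (of_real r + z)))"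
      using poly_pderiv_prod_linear[of "image_mset complex_of_real R" z] nz
      by (simp add: P_def Q_def distrib_left image_mset.compositionality o_def)
    moreover have "poly P z = 0"
      using that unfolding A poly_prod_mset by auto
    moreover have "poly Q z \<noteq> 0"
      using nz unfolding Q_def poly_prod_mset by auto
    ultimately show False
      using sum_inverse_shift_neq_minus_1[OF R z] by (simp add: add_eq_0_iff)
  qed
  define R' where "R' = image_mset (\<lambda>z. - Re z) A"
  have "poly (?Q + pderiv ?Q) x = poly (\<Prod>r\<in>#R'. [:r, 1:]) x" for x
  proof -
    have "complex_of_real (poly (?Q + pderiv ?Q) x) = poly (\<Prod>z\<in>#A. [:-z, 1:]) (of_real x)"
      using P_real A by simp
    also have "\<dots> = of_real (poly (\<Prod>r\<in>#R'. [:r, 1:]) x)"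
      using root unfolding R'_def by (induction A) (auto simp: complex_eq_iff)
    finally show ?thesis by (simp only: of_real_eq_iff)
  qed
  then have "?Q + pderiv ?Q = (\<Prod>r\<in>#R'. [:r, 1:])"
    by (simp add: poly_eq_poly_eq_iff[symmetric] fun_eq_iff)
  moreover have "\<forall>r\<in>#R'. 0 \<le> r" using root by (auto simp: R'_def)
  ultimately show ?thesis using that by blast
qed

section \<open>Touchard polynomials and the mean of the Stirling distribution\<close>

definition touchard :: "nat \<Rightarrow> real poly" where
  "touchard n = (\<Sum>k\<le>n. monom (real (Stirling n k)) k)"

lemma coeff_touchard [simp]: "coeff (touchard n) k = real (Stirling n k)"
  by (simp add: touchard_def coeff_sum)

lemma touchard_0 [simp]: "touchard 0 = 1"
  by (simp add: touchard_def)

text \<open>Coefficientwise this is the recurrence S(n+1, k+1) = (k+1) S(n, k+1) + S(n, k).\<close>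

lemma touchard_Suc: "touchard (Suc n) = [:0, 1:] * (touchard n + pderiv (touchard n))"
proof (rule poly_eqI)
  show "coeff (touchard (Suc n)) k = coeff ([:0, 1:] * (touchard n + pderiv (touchard n))) k" for k
    by (cases k) (simp_all add: coeff_pderiv algebra_simps)
qed

lemma touchard_splits:
  obtains R where "\<forall>r\<in>#R. 0 \<le> r" "touchard n = (\<Prod>r\<in>#R. [:r, 1:])"
proof -
  have "\<exists>R. (\<forall>r\<in>#R. 0 \<le> r) \<and> touchard n = (\<Prod>r\<in>#R. [:r, 1:])"
  proof (induction n)
    case 0
    show ?case by (rule exI[of _ "{#}"]) simp
  next
    case (Suc n)
    then obtain R where "\<forall>r\<in>#R. 0 \<le> r" and R: "touchard n = (\<Prod>r\<in>#R. [:r, 1:])" by blast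
    then obtain R' where "\<forall>r\<in>#R'. 0 \<le> r" "touchard n + pderiv (touchard n) = (\<Prod>r\<in>#R'. [:r, 1:])"
      using splits_add_pderiv by metis
    then show ?case
      by (intro exI[of _ "add_mset 0 R'"]) (simp add: touchard_Suc del: mult_pCons_left)
  qed
  then show ?thesis using that by blast
qed

lemma Stirling_pos: "1 \<le> k \<Longrightarrow> k \<le> n \<Longrightarrow> 0 < Stirling n k"
proof (induction n arbitrary: k)
  case (Suc n)
  then obtain j where j: "k = Suc j" by (cases k) auto
  show ?case
  proof (cases "Suc j \<le> n")
    case True
    then show ?thesis using Suc.IH[of "Suc j"] j by simp
  next
    case False
    then show ?thesis using j Suc.prems by (simp add: le_Suc_eq)
  qed
qed simp

definition bell :: "nat \<Rightarrow> real" where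
  "bell n = (\<Sum>k\<le>n. real (Stirling n k))"

lemma bell_eq_poly_touchard: "bell n = poly (touchard n) 1"
  by (simp add: bell_def touchard_def poly_sum poly_monom)

text \<open>The mean of S(n, k) / B_n is T'(1) / T(1), which \<open>touchard_Suc\<close> at 1
  identifies with B_{n+1} / B_n - 1. The two sides of Darroch's theorem then apply.\<close>

lemma Stirling_monotone_around_mean:
  shows "real (Suc j) < bell (Suc n) / bell n - 1 \<Longrightarrow> Stirling n j < Stirling n (Suc j)"
    and "bell (Suc n) / bell n - 1 \<le> real j \<Longrightarrow> Stirling n (Suc j) \<le> Stirling n j"
proof -
  obtain R where R: "\<forall>r\<in>#R. 0 \<le> r" and T: "touchard n = (\<Prod>r\<in>#R. [:r, 1:])"
    using touchard_splits .
  have "poly (touchard n) 1 \<noteq> 0"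
    using R unfolding T poly_prod_mset by fastforce
  moreover have "poly (pderiv (touchard n)) 1 = poly (touchard n) 1 * (\<Sum>r\<in>#R. 1 / (r + 1))"
    unfolding T using R by (intro poly_pderiv_prod_linear) fastforce
  ultimately have mean: "bell (Suc n) / bell n - 1 = (\<Sum>r\<in>#R. 1 / (r + 1))"
    by (simp add: bell_eq_poly_touchard touchard_Suc field_simps)
  {
    assume less: "real (Suc j) < bell (Suc n) / bell n - 1"
    \<comment> \<open>The mean is at most \<open>n\<close>, so \<open>Suc j \<le> n\<close> and S(n,
      j+1) is positive, as the strict inequality requires.\<close>
    have "(\<Sum>r\<in>#R. 1 / (r + 1)) \<le> (\<Sum>r\<in>#R. 1)"
      using R by (intro sum_mset_mono) auto
    then have "(\<Sum>r\<in>#R. 1 / (r + 1)) \<le> real (size R)"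
      by simp
    moreover have "size R = n"
    proof -
      have "degree (touchard n) = n"
        by (intro antisym degree_le le_degree) auto
      then show ?thesis using T degree_prod_linear by metis
    qed
    ultimately have "Suc j \<le> n" using less mean by linarith
    then have "0 < coeff (touchard n) (Suc j)" by (simp add: Stirling_pos)
    then have "coeff (touchard n) j < coeff (touchard n) (Suc j)"
      using less R unfolding T mean by (intro coeff_prod_linear_less_of_mean)
    then show "Stirling n j < Stirling n (Suc j)" by simp
  }
  {
    assume "bell (Suc n) / bell n - 1 \<le> real j"
    then have "coeff (touchard n) (Suc j) \<le> coeff (touchard n) j"
      using R unfolding T mean by (intro coeff_prod_linear_ge_of_mean)
    then show "Stirling n (Suc j) \<le> Stirling n j" by simp
  }
qed

subsection \<open>Bounds for ratios of consecutive Bell numbers\<close>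

lemma sums_inverse_fact_shift:
  "(\<lambda>k. if j \<le> k then 1 / fact (k - j) else 0) sums exp (1 :: real)"
proof -
  have "(\<lambda>k. 1 / fact k) sums exp (1 :: real)"
    using exp_converges[of "1 :: real"] by (simp add: divide_inverse)
  then show ?thesis
    by (subst sums_zero_iff_shift[of j, symmetric]) auto
qed

text \<open>The expansion of k^n in falling factorials, divided by k!; the conditional term is the
  falling factorial of order \<open>j\<close> over k!.\<close>

lemma power_div_fact_eq_sum_Stirling:
  "real k ^ n / fact k = (\<Sum>j\<le>n. real (Stirling n j) * (if j \<le> k then 1 / fact (k - j) else 0))"
proof (induction n)
  case (Suc n)
  define g :: "nat \<Rightarrow> real" where "g j = (if j \<le> k then 1 / fact (k - j) else 0)" for j
  have g: "real k * g j = real j * g j + g (Suc j)" for j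
  proof (cases "j < k")
    case True
    then obtain l where k: "k = Suc (j + l)" by (metis less_iff_Suc_add)
    then have "real (Suc l) * g j = g (Suc j)"
      by (simp add: g_def Suc_diff_le del: of_nat_Suc)
    moreover have "real k = real j + real (Suc l)" using k by simp
    ultimately show ?thesis by (simp only: distrib_right)
  qed (auto simp: g_def)
  \<comment> \<open>The index shift costs nothing: the top term vanishes because S(n, n+1) = 0, the
    bottom one because of the factor \<open>j\<close>.\<close>
  have "(\<Sum>j\<le>n. real (Stirling n j) * (real j * g j)) = (\<Sum>j\<le>Suc n. real (Stirling n j) * (real j * g j))"
    by simp
  also have "\<dots> = (\<Sum>j\<le>n. real (Stirling n (Suc j)) * (real (Suc j) * g (Suc j)))"
    unfolding sum.atMost_Suc_shift by simp
  finally have shift: "(\<Sum>j\<le>n. real (Stirling n j) * (real j * g j)) = \<dots>" .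
  have "real k ^ Suc n / fact k = (\<Sum>j\<le>n. real (Stirling n j) * (real k * g j))"
    using Suc unfolding g_def[symmetric] by (simp add: sum_distrib_left mult_ac flip: times_divide_eq_right)
  also have "\<dots> = (\<Sum>j\<le>n. real (Stirling n j) * (real j * g j)) + (\<Sum>j\<le>n. real (Stirling n j) * g (Suc j))"
    unfolding g by (simp add: distrib_left sum.distrib)
  also have "\<dots> = (\<Sum>j\<le>n. real (Stirling (Suc n) (Suc j)) * g (Suc j))"
    unfolding shift sum.distrib[symmetric] by (rule sum.cong) (simp_all add: algebra_simps)
  also have "\<dots> = (\<Sum>j\<le>Suc n. real (Stirling (Suc n) j) * g j)"
    unfolding sum.atMost_Suc_shift by simp
  finally show ?case unfolding g_def .
qed simp

lemma Dobinski: "(\<lambda>k. real k ^ n / fact k) sums (exp 1 * bell n)"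
proof -
  have "(\<lambda>k. \<Sum>j\<le>n. real (Stirling n j) * (if j \<le> k then 1 / fact (k - j) else 0))
    sums (\<Sum>j\<le>n. real (Stirling n j) * exp 1)"
    by (intro sums_sum sums_mult sums_inverse_fact_shift)
  then show ?thesis
    unfolding power_div_fact_eq_sum_Stirling[symmetric] by (simp add: bell_def sum_distrib_left mult_ac)
qed

lemma Dobinski_shift: "(\<lambda>k. real (Suc k) ^ n / fact k) sums (exp 1 * bell (Suc n))"
proof -
  have "(\<lambda>k. real (Suc k) ^ Suc n / fact (Suc k)) sums (exp 1 * bell (Suc n))"
    using Dobinski[of "Suc n"] by (subst sums_Suc_iff) simp
  moreover have "real (Suc k) ^ Suc n / fact (Suc k) = real (Suc k) ^ n / fact k" for k
    by (simp del: of_nat_Suc)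
  ultimately show ?thesis by simp
qed

lemma bell_pos: "0 < bell n"
proof -
  have "real (Stirling n n) \<le> bell n"
    unfolding bell_def by (rule member_le_sum) auto
  then show ?thesis by simp
qed

lemma bell_ratio_lower:
  assumes "n > 0" "0 < c" "bell (Suc n) / bell n \<le> c"
  shows "(1 + 1 / c) ^ n \<le> bell (Suc n) / bell n"
proof -
  \<comment> \<open>\<open>a * (1 + b * (c - y))\<close> is the tangent at \<open>y = c\<close> of
    the convex function (1 + 1/y)^n.\<close>
  define a b where "a = (1 + 1 / c) ^ n" and "b = real n / (c\<^sup>2 * (1 + 1 / c))"
  have pos: "0 < a" "0 < b" using assms by (auto simp: a_def b_def add_pos_pos)
  \<comment> \<open>The tangent inequality times k^n, which also covers \<open>k = 0\<close>. It
    combines Bernoulli's inequality in \<open>t\<close> with the tangent of 1/y at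
    \<open>c\<close>.\<close>
  have le: "a * (real k ^ n * (1 + b * (c - real k))) \<le> real (Suc k) ^ n" for k
  proof (cases "k = 0")
    case False
    then have k: "real k > 0" by simp
    define t where "t = (1 / real k - 1 / c) / (1 + 1 / c)"
    have c: "0 < 1 + 1 / c" using assms by (simp add: add_pos_pos)
    then have t: "(1 + 1 / c) * (1 + t) = 1 + 1 / real k"
      by (simp add: t_def distrib_left)
    have "0 \<le> (1 + 1 / c) * (1 + t)" unfolding t by simp
    then have "-1 \<le> t" using c by (simp add: zero_le_mult_iff)
    have "(c - real k) / c\<^sup>2 \<le> 1 / real k - 1 / c"
    proof -
      have "1 / real k - 1 / c - (c - real k) / c\<^sup>2 = (c - real k)\<^sup>2 / (real k * c\<^sup>2)"
        using k assms by (simp add: field_simps power2_eq_square)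
      also have "\<dots> \<ge> 0" using k by simp
      finally show ?thesis by simp
    qed
    then have "real n * ((c - real k) / c\<^sup>2) / (1 + 1 / c) \<le> real n * (1 / real k - 1 / c) / (1 + 1 / c)"
      using assms by (intro divide_right_mono mult_left_mono) auto
    then have "1 + b * (c - real k) \<le> 1 + real n * t"
      by (simp add: b_def t_def mult_ac)
    also have "\<dots> \<le> (1 + t) ^ n"
      using \<open>-1 \<le> t\<close> by (rule Bernoulli_inequality)
    finally have "a * (real k ^ n * (1 + b * (c - real k))) \<le> a * (real k ^ n * (1 + t) ^ n)"
      using pos by (intro mult_left_mono) auto
    also have "\<dots> = ((1 + 1 / c) * (real k * (1 + t))) ^ n"
      by (simp add: a_def power_mult_distrib)
    also have "(1 + 1 / c) * (real k * (1 + t)) = real k * (1 + 1 / real k)"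
      unfolding t[symmetric] by (simp only: mult_ac)
    also have "\<dots> = real (Suc k)" using k by (simp add: field_simps)
    finally show ?thesis .
  qed (use assms in \<open>simp add: power_0_left\<close>)
  have "(\<lambda>k. a * ((1 + b * c) * (real k ^ n / fact k) - b * (real k ^ Suc n / fact k)))
      sums (a * ((1 + b * c) * (exp 1 * bell n) - b * (exp 1 * bell (Suc n))))"
    by (intro sums_mult sums_diff Dobinski)
  moreover have "a * ((1 + b * c) * (real k ^ n / fact k) - b * (real k ^ Suc n / fact k)) \<le> real (Suc k) ^ n / fact k" for k
  proof -
    have "a * ((1 + b * c) * (real k ^ n / fact k) - b * (real k ^ Suc n / fact k))
      = a * (real k ^ n * (1 + b * (c - real k))) / fact k"
      by (simp add: field_simps)
    also have "\<dots> \<le> real (Suc k) ^ n / fact k"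
      by (intro divide_right_mono le) simp
    finally show ?thesis .
  qed
  ultimately have "a * ((1 + b * c) * (exp 1 * bell n) - b * (exp 1 * bell (Suc n))) \<le> exp 1 * bell (Suc n)"
    by (intro sums_le[OF _ _ Dobinski_shift])
  then have "exp 1 * (a * (bell n + b * (c * bell n - bell (Suc n)))) \<le> exp 1 * bell (Suc n)"
    by (simp add: algebra_simps)
  then have "a * (bell n + b * (c * bell n - bell (Suc n))) \<le> bell (Suc n)"
    by simp
  moreover have "0 \<le> a * (b * (c * bell n - bell (Suc n)))"
    using pos assms(3) bell_pos[of n] by (simp add: field_simps)
  ultimately have "a * bell n \<le> bell (Suc n)"
    by (simp add: distrib_left)
  then show ?thesis using bell_pos[of n] by (simp add: a_def field_simps)
qed

lemma bell_ratio_upper: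
  assumes "n > 0" "1 < c" "c \<le> bell (Suc n) / bell n"
  shows "(1 - 1 / c) ^ n * (bell (Suc n) / bell n) \<le> 1"
proof -
  obtain m where n: "n = Suc m" using assms(1) by (cases n) auto
  \<comment> \<open>\<open>a * (1 + d * (1 / c - u))\<close> is the tangent of (1 - u)^n at
    \<open>u = 1 / c\<close>, taken at \<open>u = 1 / j\<close>. Multiplied by \<open>j\<close> it
    is affine in \<open>j\<close>, so summation involves only two Bell numbers.\<close>
  define a d where "a = (1 - 1 / c) ^ n" and "d = real n / (1 - 1 / c)"
  have c: "0 < 1 - 1 / c" using assms by simp
  have pos: "0 < a" "0 < d" using assms c by (auto simp: a_def d_def)
  have le: "a * ((1 + d / c) * real (Suc k) ^ n - d * real (Suc k) ^ m) \<le> real k ^ n" for k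
  proof -
    define j where "j = real (Suc k)"
    have j: "1 \<le> j" by (simp add: j_def)
    define t where "t = (1 / c - 1 / j) / (1 - 1 / c)"
    have t: "(1 - 1 / c) * (1 + t) = 1 - 1 / j"
      unfolding t_def using c assms(2) by (simp add: distrib_left)
    have "0 \<le> (1 - 1 / c) * (1 + t)" unfolding t using j by simp
    then have "-1 \<le> t" using c by (simp add: zero_le_mult_iff)
    then have B: "1 + real n * t \<le> (1 + t) ^ n" by (rule Bernoulli_inequality)
    have "a * ((1 + d / c) * j ^ n - d * j ^ m) = a * (j ^ n * (1 + d * (1 / c - 1 / j)))"
      using j by (simp add: n field_simps)
    also have "d * (1 / c - 1 / j) = real n * t"
      by (simp add: d_def t_def)
    also have "a * (j ^ n * (1 + real n * t)) \<le> a * (j ^ n * (1 + t) ^ n)"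
      using pos j B by (intro mult_left_mono) auto
    also have "\<dots> = ((1 - 1 / c) * (j * (1 + t))) ^ n"
      by (simp add: a_def power_mult_distrib)
    also have "(1 - 1 / c) * (j * (1 + t)) = j * (1 - 1 / j)"
      unfolding t[symmetric] by (simp only: mult_ac)
    also have "\<dots> = real k" using j by (simp add: field_simps j_def)
    finally show ?thesis by (simp only: j_def)
  qed
  have "(\<lambda>k. a * ((1 + d / c) * (real (Suc k) ^ n / fact k) - d * (real (Suc k) ^ m / fact k)))
      sums (a * ((1 + d / c) * (exp 1 * bell (Suc n)) - d * (exp 1 * bell (Suc m))))"
    by (intro sums_mult sums_diff Dobinski_shift)
  moreover have "a * ((1 + d / c) * (real (Suc k) ^ n / fact k) - d * (real (Suc k) ^ m / fact k)) \<le> real k ^ n / fact k" for k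
  proof -
    have "a * ((1 + d / c) * (real (Suc k) ^ n / fact k) - d * (real (Suc k) ^ m / fact k))
      = a * ((1 + d / c) * real (Suc k) ^ n - d * real (Suc k) ^ m) / fact k"
      by (simp add: diff_divide_distrib right_diff_distrib)
    also have "\<dots> \<le> real k ^ n / fact k"
      by (intro divide_right_mono le) simp
    finally show ?thesis .
  qed
  ultimately have "a * ((1 + d / c) * (exp 1 * bell (Suc n)) - d * (exp 1 * bell (Suc m))) \<le> exp 1 * bell n"
    by (intro sums_le[OF _ _ Dobinski])
  then have "exp 1 * (a * (bell (Suc n) + d * (bell (Suc n) / c - bell n))) \<le> exp 1 * bell n"
    by (simp add: n algebra_simps)
  then have "a * (bell (Suc n) + d * (bell (Suc n) / c - bell n)) \<le> bell n"
    by simp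
  moreover have "0 \<le> a * (d * (bell (Suc n) / c - bell n))"
    using pos assms(2,3) bell_pos[of n] by (simp add: field_simps)
  ultimately have "a * bell (Suc n) \<le> bell n"
    by (simp add: distrib_left)
  then show ?thesis using bell_pos[of n] by (simp add: a_def field_simps)
qed

text \<open>Take \<open>c\<close> to be E - 1 or E + 1 with \<open>E = exp w\<close>: then 1 +
  1/(E-1) and 1 - 1/(E+1) are the reciprocals of 1 - 1/E and 1 + 1/E, whose n-th powers are at most
  1/E and E because n/E = w.\<close>

lemma bell_ratio_bounds:
  assumes "0 < w" "real n = w * exp w"
  shows "exp w - 1 < bell (Suc n) / bell n" "bell (Suc n) / bell n < exp w + 1"
proof -
  have E: "1 < exp w" using assms by simp
  have n: "n > 0" using assms by (cases n) auto
  have nE: "real n / exp w = w" using assms by simp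
  show "exp w - 1 < bell (Suc n) / bell n"
  proof (rule ccontr)
    assume "\<not> ?thesis"
    then have le: "bell (Suc n) / bell n \<le> exp w - 1" by simp
    have "(1 - 1 / exp w) ^ n \<le> exp (- 1 / exp w) ^ n"
      using E exp_ge_add_one_self[of "- 1 / exp w"] by (intro power_mono) auto
    also have "\<dots> = exp (- w)" using nE by (simp flip: exp_of_nat_mult)
    finally have "exp w * (1 - 1 / exp w) ^ n \<le> 1"
      by (simp add: exp_minus field_simps)
    moreover have "(1 + 1 / (exp w - 1)) * (1 - 1 / exp w) = 1"
      using E by (simp add: field_simps)
    then have "(1 + 1 / (exp w - 1)) ^ n * (1 - 1 / exp w) ^ n = 1"
      by (simp flip: power_mult_distrib)
    moreover have "0 < (1 - 1 / exp w) ^ n" using E by simp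
    ultimately have "exp w \<le> (1 + 1 / (exp w - 1)) ^ n"
      by (metis mult_le_cancel_right_pos)
    also have "\<dots> \<le> bell (Suc n) / bell n"
      using E n le by (intro bell_ratio_lower) auto
    finally show False using le by simp
  qed
  show "bell (Suc n) / bell n < exp w + 1"
  proof (rule ccontr)
    assume "\<not> ?thesis"
    then have ge: "exp w + 1 \<le> bell (Suc n) / bell n" by simp
    have "(1 + 1 / exp w) ^ n \<le> exp (1 / exp w) ^ n"
      using exp_ge_add_one_self[of "1 / exp w"] by (intro power_mono) auto
    also have "\<dots> = exp w" using nE by (simp flip: exp_of_nat_mult)
    finally have le: "(1 + 1 / exp w) ^ n \<le> exp w" .
    have "exp w + 1 \<noteq> 0" using E by linarith
    then have eqs: "1 - 1 / (exp w + 1) = exp w / (exp w + 1)" "1 + 1 / exp w = (exp w + 1) / exp w"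
      by (simp_all add: field_simps)
    then have "(1 - 1 / (exp w + 1)) * (1 + 1 / exp w) = 1"
      using \<open>exp w + 1 \<noteq> 0\<close> unfolding eqs by simp
    then have "(1 - 1 / (exp w + 1)) ^ n * (1 + 1 / exp w) ^ n = 1"
      by (simp flip: power_mult_distrib)
    moreover have p: "0 < (1 - 1 / (exp w + 1)) ^ n" unfolding eqs by (simp add: add_pos_pos)
    ultimately have "1 \<le> (1 - 1 / (exp w + 1)) ^ n * exp w"
      using le by (metis mult_le_cancel_left_pos)
    also have "\<dots> < (1 - 1 / (exp w + 1)) ^ n * (bell (Suc n) / bell n)"
      using ge p by (intro mult_strict_left_mono) auto
    also have "\<dots> \<le> 1"
      using E n ge by (intro bell_ratio_upper) auto
    finally show False by simp
  qed
qed

subsection \<open>The mode\<close>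

lemma lambertW:
  assumes "0 < x"
  shows "0 < lambertW x" "x = lambertW x * exp (lambertW x)"
proof -
  \<comment> \<open>On [0, x] the function w e^w runs from 0 to a value of at least
    \<open>x\<close>.\<close>
  have "\<exists>w\<ge>0. w \<le> x \<and> w * exp w = x"
    using assms by (intro IVT') (auto intro!: continuous_intros)
  then obtain w where w: "0 \<le> w" "x = w * exp w" by auto
  then have "0 < w" using assms by (cases "w = 0") auto
  have "lambertW x > 0 \<and> x = lambertW x * exp (lambertW x)"
    unfolding lambertW_def
  proof (rule theI[of _ w])
    fix v assume v: "v > 0 \<and> x = v * exp v"
    have mono: "a * exp a < b * exp b" if "0 < a" "a < b" for a b :: real
      using that by (intro mult_strict_mono) auto
    show "v = w"
      using mono[of v w] mono[of w v] v w \<open>0 < w\<close> by (metis less_irrefl linorder_neqE)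
  qed (use w \<open>0 < w\<close> in auto)
  then show "0 < lambertW x" "x = lambertW x * exp (lambertW x)" by auto
qed

lemma stirling_mode:
  assumes "n \<ge> 1"
  shows "1 \<le> stirling_mode n" "Stirling n (stirling_mode n - 1) < Stirling n (stirling_mode n)"
    "Stirling n (stirling_mode n + 1) \<le> Stirling n (stirling_mode n)"
proof -
  define M where "M = bell (Suc n) / bell n - 1"
  define P where "P k \<longleftrightarrow> 1 \<le> k \<and> k \<le> n \<and> Stirling n (k - 1) < Stirling n k \<and> Stirling n k \<ge> Stirling n (k + 1)" for k
  have range: "M - 1 \<le> real k \<and> real k < M + 1" if "P k" for k
  proof (intro conjI)
    show "M - 1 \<le> real k"
      using that Stirling_monotone_around_mean(1)[where j = k and n = n] by (force simp: P_def M_def)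
    show "real k < M + 1"
      using that Stirling_monotone_around_mean(2)[where j = "k - 1" and n = n] by (force simp: P_def M_def)
  qed
  \<comment> \<open>The first index from 1 on that is not followed by a strict ascent; minimality
    gives the ascent into it.\<close>
  define K where "K = (LEAST k. 1 \<le> k \<and> Stirling n (k + 1) \<le> Stirling n k)"
  have ex: "1 \<le> n \<and> Stirling n (n + 1) \<le> Stirling n n" using assms by simp
  have K: "1 \<le> K \<and> Stirling n (K + 1) \<le> Stirling n K"
    unfolding K_def by (rule LeastI[of _ n]) (fact ex)
  have "K \<le> n" unfolding K_def by (rule Least_le) (fact ex)
  have "Stirling n (K - 1) < Stirling n K"
  proof (cases "K = 1")
    case True
    moreover have "Stirling n 0 = 0" using assms by (cases n) auto
    ultimately show ?thesis using Stirling_pos[of 1 n] assms by simp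
  next
    case False
    then have "\<not> (1 \<le> K - 1 \<and> Stirling n (K - 1 + 1) \<le> Stirling n (K - 1))"
      using K unfolding K_def by (intro not_less_Least) auto
    then show ?thesis using False K by auto
  qed
  then have "P K" using K \<open>K \<le> n\<close> by (simp add: P_def)
  \<comment> \<open>Both indices lie in the half-open interval [M - 1, M + 1), so they differ by at
    most 1. Neighbours are excluded, since the larger one requires an ascent that the smaller one
    forbids.\<close>
  moreover have "k = K" if "P k" for k
  proof -
    have "k \<noteq> Suc K" "K \<noteq> Suc k"
      using that \<open>P K\<close> by (auto simp: P_def)
    then show ?thesis using range[OF that] range[OF \<open>P K\<close>] by linarith
  qed
  ultimately have "P (stirling_mode n)"
    unfolding stirling_mode_def P_def[symmetric] by (rule theI)
  then show "1 \<le> stirling_mode n" "Stirling n (stirling_mode n - 1) < Stirling n (stirling_mode n)"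
    "Stirling n (stirling_mode n + 1) \<le> Stirling n (stirling_mode n)"
    by (auto simp: P_def)
qed

theorem theorem1:
  fixes n :: nat
  assumes "n \<ge> 2"
  shows "\<lfloor>exp (lambertW (real n))\<rfloor> - 2 \<le> int (stirling_mode n)
       \<and> int (stirling_mode n) \<le> \<lfloor>exp (lambertW (real n))\<rfloor> + 1"
proof -
  define K E where "K = stirling_mode n" and "E = exp (lambertW (real n))"
  have mode: "1 \<le> K" "Stirling n (K - 1) < Stirling n K" "Stirling n (Suc K) \<le> Stirling n K"
    using stirling_mode[of n] assms by (auto simp: K_def)
  have mean: "E - 1 < bell (Suc n) / bell n" "bell (Suc n) / bell n < E + 1"
    using bell_ratio_bounds lambertW[of "real n"] assms by (auto simp: E_def)
  \<comment> \<open>The mean lies strictly between E - 2 and E, and the mode is within 1 of it.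
    Integrality of \<open>K\<close> then gives the bounds with the floor.\<close>
  have "real K > E - 3"
    using Stirling_monotone_around_mean(1)[where j = K and n = n] mode mean by force
  moreover have "real K < E + 1"
    using Stirling_monotone_around_mean(2)[where j = "K - 1" and n = n] mode mean by force
  ultimately show ?thesis
    unfolding K_def[symmetric] E_def[symmetric] by linarith
qed

end
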